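(* Let $d\geq 3$ be an integer and let $q\geq 2$ be real. Let $w_c=w_c(q)=\frac{q-2}{(q-1)^{1-2/d}-1}-1$ if $q>2$ and $w_c(2)=\frac{2}{d-2}$. If $0\leq w\leq w_c$, then $\Phi_{d,q,w}=q\left(1+\frac{w}{q}\right)^{d/2}$. If $w>w_c$, then $\Phi_{d,q,w}>q\left(1+\frac{w}{q}\right)^{d/2}$.
   Context: For $w\ge 0$, $\Phi_{d,q,w}=\max_{t\in[-\pi,\pi]}\Phi_{d,q,w}(t)$, where $$\Phi_{d,q,w}(t)=\left(\sqrt{1+\frac{w}{q}}\cos(t)+\sqrt{\frac{(q-1)w}{q}}\sin(t)\right)^{d}+(q-1)\left(\sqrt{1+\frac{w}{q}}\cos(t)-\sqrt{\frac{w}{q(q-1)}}\sin(t)\right)^{d}.$$ *)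

theory Defs
  imports "HOL-Analysis.Analysis"
begin

definition Phi :: "nat \<Rightarrow> real \<Rightarrow> real \<Rightarrow> real \<Rightarrow> real" where
  "Phi d q w t =
     (sqrt (1 + w / q) * cos t + sqrt ((q - 1) * w / q) * sin t) ^ d
     + (q - 1) * (sqrt (1 + w / q) * cos t - sqrt (w / (q * (q - 1))) * sin t) ^ d"

definition Phi_max :: "nat \<Rightarrow> real \<Rightarrow> real \<Rightarrow> real" where
  "Phi_max d q w = (GREATEST y. y \<in> Phi d q w ` {-pi..pi})"

(* The maximum exists, so the choice made by Greatest is the genuine one. *)
lemma Phi_max_attained:
  shows "Phi_max d q w \<in> Phi d q w ` {-pi..pi}"
    and "\<And>t. t \<in> {-pi..pi} \<Longrightarrow> Phi d q w t \<le> Phi_max d q w"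
proof -
  have cont: "continuous_on {-pi..pi} (Phi d q w)"
    unfolding Phi_def by (intro continuous_intros)
  have ne: "{-pi..pi} \<noteq> ({} :: real set)" by simp
  obtain s where s: "s \<in> {-pi..pi}" "\<And>t. t \<in> {-pi..pi} \<Longrightarrow> Phi d q w t \<le> Phi d q w s"
    using continuous_attains_sup[OF compact_Icc ne cont] by blast
  have eq: "Phi_max d q w = Phi d q w s"
    unfolding Phi_max_def by (rule Greatest_equality) (use s in auto)
  show "Phi_max d q w \<in> Phi d q w ` {-pi..pi}" using eq s(1) by simp
  show "\<And>t. t \<in> {-pi..pi} \<Longrightarrow> Phi d q w t \<le> Phi_max d q w" using eq s(2) by simp
qed

(* Only used for q \<ge> 2. *)
definition w_c :: "nat \<Rightarrow> real \<Rightarrow> real" where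
  "w_c d q =
     (if q = 2 then 2 / (real d - 2)
      else (q - 2) / ((q - 1) powr (1 - 2 / real d) - 1) - 1)"

end

theory Submission
  imports Defs
begin

text \<open>
  Put \<open>r = q - 1\<close>, \<open>z = r powr (1/d)\<close> and let \<open>X\<close>, \<open>Y\<close> be the two bases in \<open>Phi\<close>. The pair
  \<open>(X, Y)\<close> runs through an ellipse, and \<open>w = w_c\<close> is precisely the value for which the equation of
  this ellipse is symmetric in \<open>X\<close> and \<open>z Y\<close>. The bound for \<open>w \<le> w_c\<close> then becomes an inequality
  \<open>(x^d + y^d) powr (2/d) \<le> a (x^2 + y^2) - B x y\<close> with equality at \<open>y/x = z\<close>. For \<open>y/x = exp s\<close>
  it says that \<open>(2 cosh (d s/2)) powr (2/d)\<close>, a concave function of \<open>cosh s\<close>, lies below its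
  tangent at \<open>exp s = z\<close>; the concavity amounts to \<open>(d - 1) sinh s \<le> sinh ((d - 1) s)\<close>.

  For \<open>w > w_c\<close> and \<open>q > 2\<close>, the linear forms \<open>X\<close> and \<open>Y\<close> on the unit circle have norms of ratio
  \<open>g > z\<close>, and the reflection exchanging their directions takes the point \<open>t = 0\<close>, where
  \<open>X = Y = \<alpha>\<close>, to \<open>X = \<alpha> g\<close>, \<open>Y = \<alpha> / g\<close>, where \<open>Phi\<close> is larger. For \<open>q = 2\<close> these points
  coincide, and instead the second derivative of \<open>Phi\<close> at \<open>0\<close> is positive.
\<close>


section \<open>Monotonicity of the slope\<close>

text \<open>For \<open>z = exp s\<close>, division by \<open>2 * z^(n+1)\<close> turns this into
  \<open>n sinh s \<le> sinh (n s)\<close>. The induction is the addition formula for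
  \<open>sinh ((n + 1) s)\<close> together with \<open>cosh \<ge> 1\<close>.\<close>

lemma mult_power_le_power_diff:
  fixes z :: real
  assumes "z \<ge> 1"
  shows "real n * z ^ n * (z\<^sup>2 - 1) \<le> z * (z ^ (2 * n) - 1)"
proof (induction n)
  case 0
  then show ?case by simp
next
  case (Suc n)
  \<comment> \<open>This square encodes \<open>cosh (n s) \<ge> 1\<close>; the square of
    \<open>z - 1\<close> below encodes \<open>cosh s \<ge> 1\<close>.\<close>
  have "0 \<le> (z ^ n - 1)\<^sup>2" by simp
  then have "2 * z ^ n \<le> z ^ (2 * n) + 1"
    by (simp add: power2_diff power_even_eq[symmetric] algebra_simps)
  then have 1: "(2 * z ^ n) * (z * (z\<^sup>2 - 1)) \<le> (z ^ (2 * n) + 1) * (z * (z\<^sup>2 - 1))"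
    using assms by (intro mult_right_mono) auto
  have "0 \<le> (z - 1)\<^sup>2" by simp
  then have "2 * z \<le> z\<^sup>2 + 1"
    by (simp add: power2_eq_square algebra_simps)
  moreover have "0 \<le> z * (z ^ (2 * n) - 1)" using assms by simp
  ultimately have 2: "(2 * z) * (z * (z ^ (2 * n) - 1)) \<le> (z\<^sup>2 + 1) * (z * (z ^ (2 * n) - 1))"
    by (intro mult_right_mono)
  have 3: "(2 * z) * (real n * z ^ n * (z\<^sup>2 - 1)) \<le> (2 * z) * (z * (z ^ (2 * n) - 1))"
    using Suc.IH assms by (intro mult_left_mono) auto
  have "2 * (real (Suc n) * z ^ Suc n * (z\<^sup>2 - 1))
      = (2 * z) * (real n * z ^ n * (z\<^sup>2 - 1)) + (2 * z ^ n) * (z * (z\<^sup>2 - 1))"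
    by (simp add: algebra_simps)
  also have "\<dots> \<le> (z\<^sup>2 + 1) * (z * (z ^ (2 * n) - 1)) + (z ^ (2 * n) + 1) * (z * (z\<^sup>2 - 1))"
    using 1 2 3 by linarith
  also have "\<dots> = 2 * (z * (z ^ (2 * Suc n) - 1))"
    by (simp add: algebra_simps power2_eq_square)
  finally show ?case by simp
qed

text \<open>
  For \<open>z = exp s\<close> this is half the derivative of \<open>(2 cosh (d s/2)) powr (2/d)\<close> with respect to
  \<open>cosh s\<close>. Writing \<open>(z^d - 1)/(z - 1)\<close> as a sum keeps the formula valid at \<open>z = 1\<close>, the case \<open>q = 2\<close>.
\<close>
definition slope :: "nat \<Rightarrow> real \<Rightarrow> real" where
  "slope d z = (z ^ d + 1) powr (2 / real d - 1) * (\<Sum>i<d. z ^ i) / (z + 1)"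

lemma slope_mult:
  assumes "z \<noteq> -1"
  shows "slope d z * (z\<^sup>2 - 1) = (z ^ d + 1) powr (2 / real d - 1) * (z ^ d - 1)"
proof -
  have "z + 1 \<noteq> 0" using assms by linarith
  then have "slope d z * (z\<^sup>2 - 1) = (z ^ d + 1) powr (2 / real d - 1) * ((z - 1) * (\<Sum>i<d. z ^ i))"
    by (simp add: slope_def field_simps power2_eq_square)
  then show ?thesis by (simp only: power_diff_1_eq)
qed

text \<open>This is the concavity in \<open>cosh s\<close>. Off \<open>z = 1\<close> the slope
  equals the quotient \<open>g\<close>, whose derivative has the sign of
  \<open>n z^n (z^2 - 1) - z (z^(2n) - 1)\<close> with \<open>n = d - 1\<close>. The endpoint
  \<open>z = 1\<close> is covered by continuity of the sum form.\<close>

lemma slope_antimono: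
  assumes d: "d \<ge> 1" and "1 \<le> x" "x \<le> y"
  shows "slope d y \<le> slope d x"
proof (rule DERIV_nonpos_imp_decreasing_open[OF \<open>x \<le> y\<close>])
  show "continuous_on {x..y} (slope d)"
  proof -
    have "u ^ d + 1 > 0" "u + 1 \<noteq> 0" if "u \<in> {x..y}" for u
      using that assms by (auto intro: add_nonneg_pos)
    then show ?thesis unfolding slope_def
      by (intro continuous_intros) (auto simp: less_imp_neq[symmetric])
  qed
next
  fix z assume "x < z" "z < y"
  with assms have z: "z > 1" by simp
  define p where "p = 2 / real d"
  define u where "u = (z ^ d + 1) powr (p - 2)"
  define g where "g = (\<lambda>z. (z ^ d + 1) powr (p - 1) * (z ^ d - 1) / (z\<^sup>2 - 1))"
  obtain n where n: "d = Suc n" using d by (cases d) auto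
  have pos: "z ^ d + 1 > 0" using z by (simp add: add_pos_pos)
  have ne: "z\<^sup>2 - 1 > 0" using z by simp
  have up: "(z ^ d + 1) powr (p - 1) = u * (z ^ d + 1)"
    using pos powr_add[of "z ^ d + 1" "p - 2" 1] by (simp add: u_def)
  \<comment> \<open>The exponent \<open>2/d\<close> enters here: with this value the leading powers
    of \<open>z\<close> in the numerator cancel, leaving \<open>N\<close>.\<close>
  have pd: "(p - 1) * real d = 2 - real d" using d by (simp add: p_def field_simps)
  have double: "z ^ (2 * n) = z ^ n * z ^ n" by (simp add: mult_2 power_add)
  define N where "N = 2 * u * (real n * z ^ n * (z\<^sup>2 - 1) - z * (z ^ (2 * n) - 1))"
  have "(g has_real_derivative
      (((p - 1) * u * (real d * z ^ n) * (z ^ d - 1) + u * (z ^ d + 1) * (real d * z ^ n)) * (z\<^sup>2 - 1)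
        - u * (z ^ d + 1) * (z ^ d - 1) * (2 * z)) / (z\<^sup>2 - 1)\<^sup>2) (at z)"
    unfolding g_def
  proof -
    have Dd: "((\<lambda>z. z ^ d) has_real_derivative real d * z ^ n) (at z)"
      using DERIV_pow[of d z] by (simp add: n)
    have "((\<lambda>z. z ^ d + 1) has_real_derivative real d * z ^ n) (at z)"
      using DERIV_add[OF Dd DERIV_const] by simp
    from DERIV_fun_powr[OF this pos, of "p - 1"]
    have Dp: "((\<lambda>z. (z ^ d + 1) powr (p - 1)) has_real_derivative (p - 1) * u * (real d * z ^ n)) (at z)"
      by (simp add: u_def diff_diff_eq)
    have Dm: "((\<lambda>z. z ^ d - 1) has_real_derivative real d * z ^ n) (at z)"
      using DERIV_diff[OF Dd DERIV_const] by simp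
    have Dq: "((\<lambda>z. z\<^sup>2 - 1) has_real_derivative 2 * z) (at z)"
      by (auto intro!: derivative_eq_intros)
    show "((\<lambda>z. (z ^ d + 1) powr (p - 1) * (z ^ d - 1) / (z\<^sup>2 - 1)) has_real_derivative
      (((p - 1) * u * (real d * z ^ n) * (z ^ d - 1) + u * (z ^ d + 1) * (real d * z ^ n)) * (z\<^sup>2 - 1)
        - u * (z ^ d + 1) * (z ^ d - 1) * (2 * z)) / (z\<^sup>2 - 1)\<^sup>2) (at z)"
    proof (rule DERIV_cong[OF DERIV_divide[OF DERIV_mult[OF Dp Dm] Dq]])
      show "z\<^sup>2 - 1 \<noteq> 0" using ne by simp
    qed (simp only: up power2_eq_square mult.commute mult.left_commute mult.assoc)
  qed
  also have "((p - 1) * u * (real d * z ^ n) * (z ^ d - 1) + u * (z ^ d + 1) * (real d * z ^ n)) * (z\<^sup>2 - 1)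
        - u * (z ^ d + 1) * (z ^ d - 1) * (2 * z)
      = u * (z ^ n * (z\<^sup>2 - 1) * (((p - 1) * real d) * (z ^ d - 1) + real d * (z ^ d + 1))
          - 2 * z * (z ^ d + 1) * (z ^ d - 1))"
    by (simp add: algebra_simps)
  also have "\<dots> = N"
    unfolding pd unfolding N_def n double by (simp add: algebra_simps power2_eq_square)
  finally have D: "(g has_real_derivative N / (z\<^sup>2 - 1)\<^sup>2) (at z)" .
  have "(slope d has_real_derivative N / (z\<^sup>2 - 1)\<^sup>2) (at z)"
  proof (rule has_field_derivative_transform_within_open[OF D open_greaterThan])
    show "z \<in> {1<..}" using z by simp
    fix v :: real assume "v \<in> {1<..}"
    then have "v\<^sup>2 - 1 > 0" "v \<noteq> -1" by auto
    then show "g v = slope d v"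
      using slope_mult[of v d] by (simp add: g_def p_def field_simps)
  qed
  moreover have "N / (z\<^sup>2 - 1)\<^sup>2 \<le> 0"
    using mult_power_le_power_diff[of z n] z
    by (auto simp: N_def u_def intro!: divide_nonpos_nonneg mult_nonneg_nonpos)
  ultimately show "\<exists>D. (slope d has_real_derivative D) (at z) \<and> D \<le> 0" by blast
qed

section \<open>The tangent inequality and its two-point form\<close>

text \<open>For \<open>z = exp s\<close>, \<open>h z\<close> is a linear function of
  \<open>cosh s\<close> minus the concave function \<open>(2 cosh (d s/2)) powr (2/d)\<close>, with
  slopes matching at \<open>z0\<close>. Accordingly \<open>h'\<close> is
  \<open>slope d z0 - slope d z\<close> times a nonnegative factor and changes sign at
  \<open>z0\<close>.\<close>

lemma tangent_quotient_min:
  assumes d: "d \<ge> 1" and "z0 \<ge> 1" "z \<ge> 1"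
  defines "h \<equiv> \<lambda>z. (slope d z0 * (1 + z\<^sup>2) - (1 + z ^ d) powr (2 / real d)) / z"
  shows "h z0 \<le> h z"
proof -
  define p where "p = 2 / real d"
  have D: "(h has_real_derivative (slope d z0 - slope d z) * (z\<^sup>2 - 1) / z\<^sup>2) (at z)"
    if z: "z \<ge> 1" for z
  proof -
    obtain n where n: "d = Suc n" using d by (cases d) auto
    define u where "u = (1 + z ^ d) powr (p - 1)"
    have pos: "1 + z ^ d > 0" using z by (simp add: add_pos_nonneg)
    have up: "(1 + z ^ d) powr p = u * (1 + z ^ d)"
      using pos powr_add[of "1 + z ^ d" "p - 1" 1] by (simp add: u_def)
    have pd: "p * real d = 2" using d by (simp add: p_def)
    have "(h has_real_derivative
        ((slope d z0 * (2 * z) - p * u * (real d * z ^ n)) * z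
          - (slope d z0 * (1 + z\<^sup>2) - u * (1 + z ^ d))) / z\<^sup>2) (at z)"
    proof -
      have "((\<lambda>z. 1 + z ^ d) has_real_derivative real d * z ^ n) (at z)"
        using DERIV_add[OF DERIV_const DERIV_pow[of d z]] by (simp add: n)
      from DERIV_fun_powr[OF this pos, of p]
      have Dp: "((\<lambda>z. (1 + z ^ d) powr p) has_real_derivative p * u * (real d * z ^ n)) (at z)"
        by (simp add: u_def)
      have Dq: "((\<lambda>z. slope d z0 * (1 + z\<^sup>2)) has_real_derivative slope d z0 * (2 * z)) (at z)"
        by (auto intro!: derivative_eq_intros)
      show ?thesis
        using DERIV_divide[OF DERIV_diff[OF Dq Dp] DERIV_ident] z
        by (simp add: h_def p_def[symmetric] up power2_eq_square)
    qed
    also have "(slope d z0 * (2 * z) - p * u * (real d * z ^ n)) * z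
          - (slope d z0 * (1 + z\<^sup>2) - u * (1 + z ^ d))
        = slope d z0 * (z\<^sup>2 - 1) - (p * real d) * u * z ^ d + u * (1 + z ^ d)"
      by (simp add: n algebra_simps power2_eq_square)
    also have "\<dots> = slope d z0 * (z\<^sup>2 - 1) - u * (z ^ d - 1)"
      unfolding pd by (simp add: algebra_simps)
    also have "\<dots> = (slope d z0 - slope d z) * (z\<^sup>2 - 1)"
      using slope_mult[of z d] z by (simp add: u_def p_def algebra_simps)
    finally show ?thesis .
  qed
  have C: "continuous_on {a..b} h" if "a \<ge> 1" for a b
  proof (intro continuous_at_imp_continuous_on ballI)
    fix v assume "v \<in> {a..b}"
    then show "isCont h v" using D[of v] that by (auto intro: DERIV_isCont)
  qed
  show ?thesis
  proof (cases "z \<le> z0")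
    case True
    show ?thesis
    proof (rule DERIV_nonpos_imp_decreasing_open[OF True _ C])
      fix v assume v: "z < v" "v < z0"
      then have "(slope d z0 - slope d v) * (v\<^sup>2 - 1) / v\<^sup>2 \<le> 0"
        using slope_antimono[OF d, of v z0] assms
        by (intro divide_nonpos_nonneg mult_nonpos_nonneg) auto
      then show "\<exists>D. (h has_real_derivative D) (at v) \<and> D \<le> 0"
        using D[of v] v assms by (intro exI conjI) auto
    qed (use assms in simp)
  next
    case False
    then have le: "z0 \<le> z" by simp
    show ?thesis
    proof (rule DERIV_nonneg_imp_increasing_open[OF le _ C])
      fix v assume v: "z0 < v" "v < z"
      then have "(slope d z0 - slope d v) * (v\<^sup>2 - 1) / v\<^sup>2 \<ge> 0"
        using slope_antimono[OF d, of z0 v] assms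
        by (intro divide_nonneg_nonneg mult_nonneg_nonneg) auto
      then show "\<exists>D. (h has_real_derivative D) (at v) \<and> D \<ge> 0"
        using D[of v] v assms by (intro exI conjI) auto
    qed (use assms in simp)
  qed
qed

text \<open>\<open>B\<close> is the minimum of the tangent quotient, so equality holds at
  \<open>y / x = z0\<close>. Homogeneity reduces \<open>0 < x \<le> y\<close> to the ratio
  \<open>z = y / x\<close>, and symmetry gives the other order.\<close>

lemma power_sum_powr_le:
  assumes d: "d \<ge> 1" and z0: "z0 \<ge> 1" and "x \<ge> 0" "y \<ge> 0"
  defines "B \<equiv> (slope d z0 * (1 + z0\<^sup>2) - (1 + z0 ^ d) powr (2 / real d)) / z0"
  shows "(x ^ d + y ^ d) powr (2 / real d) \<le> slope d z0 * (x\<^sup>2 + y\<^sup>2) - B * x * y"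
proof -
  have ordered: "(x ^ d + y ^ d) powr (2 / real d) \<le> slope d z0 * (x\<^sup>2 + y\<^sup>2) - B * x * y"
    if "0 < x" "x \<le> y" for x y
  proof -
    define z where "z = y / x"
    have z: "z \<ge> 1" and y: "y = z * x" using that by (auto simp: z_def)
    have "B * z \<le> slope d z0 * (1 + z\<^sup>2) - (1 + z ^ d) powr (2 / real d)"
      using tangent_quotient_min[OF d z0 z] z unfolding B_def by (simp add: field_simps)
    then have "x\<^sup>2 * (1 + z ^ d) powr (2 / real d) \<le> x\<^sup>2 * (slope d z0 * (1 + z\<^sup>2) - B * z)"
      by (intro mult_left_mono) auto
    moreover have "(x ^ d + y ^ d) powr (2 / real d) = x\<^sup>2 * (1 + z ^ d) powr (2 / real d)"
    proof -
      have "x ^ d + y ^ d = x ^ d * (1 + z ^ d)"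
        by (simp add: y power_mult_distrib algebra_simps)
      moreover have "(x ^ d) powr (2 / real d) = x\<^sup>2"
        using powr_realpow[OF \<open>0 < x\<close>, of d] powr_powr[of x "real d" "2 / real d"] \<open>0 < x\<close> d
        by simp
      moreover have "0 \<le> x ^ d" "0 \<le> 1 + z ^ d" using \<open>0 < x\<close> z by simp_all
      ultimately show ?thesis by (simp add: powr_mult)
    qed
    ultimately show ?thesis by (simp add: y algebra_simps power2_eq_square)
  qed
  have pos: "(x ^ d + y ^ d) powr (2 / real d) \<le> slope d z0 * (x\<^sup>2 + y\<^sup>2) - B * x * y"
    if "0 < x" "0 < y" for x y
    using ordered[of x y] ordered[of y x] that by (cases "x \<le> y") (auto simp: algebra_simps)
  \<comment> \<open>Vanishing coordinates are reached by shifting both by \<open>e\<close> and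
    letting \<open>e\<close> tend to 0 from the right. By monotonicity the left side can stay
    unshifted, so only the polynomial \<open>G\<close> has to be continuous.\<close>
  define G where "G = (\<lambda>e. slope d z0 * ((x + e)\<^sup>2 + (y + e)\<^sup>2) - B * (x + e) * (y + e))"
  have "(G \<longlongrightarrow> G 0) (at_right 0)"
    unfolding G_def by (intro tendsto_eq_intros) auto
  moreover have "eventually (\<lambda>e. (x ^ d + y ^ d) powr (2 / real d) \<le> G e) (at_right 0)"
    unfolding eventually_at_right_field
  proof (intro exI[of _ 1] conjI allI impI)
    fix e :: real assume e: "0 < e"
    have "(x ^ d + y ^ d) powr (2 / real d) \<le> ((x + e) ^ d + (y + e) ^ d) powr (2 / real d)"
      using e assms by (intro powr_mono2 add_mono power_mono add_nonneg_nonneg zero_le_power) auto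
    also have "\<dots> \<le> G e" unfolding G_def using e assms by (intro pos) auto
    finally show "(x ^ d + y ^ d) powr (2 / real d) \<le> G e" .
  qed simp
  ultimately have "(x ^ d + y ^ d) powr (2 / real d) \<le> G 0"
    by (rule tendsto_lowerbound) simp
  then show ?thesis by (simp add: G_def)
qed

text \<open>The previous bound at \<open>(x, z y)\<close>, which produces the weight
  \<open>z^d\<close>. The quadratic form is factored so that equality is visible at
  \<open>x = y\<close> and at its mirror image \<open>x = z^2 y\<close> under exchanging
  \<open>x\<close> and \<open>z y\<close>. Nonnegativity of the form is recorded because
  monotonicity of \<open>powr\<close> needs it.\<close>

lemma two_point_power_le:
  assumes d: "d \<ge> 1" and z: "z \<ge> 1" and "x \<ge> 0" "y \<ge> 0"
  defines "q \<equiv> 1 + z ^ d" and "b \<equiv> (\<Sum>i<d. z ^ i) / (z + 1)"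
  shows "0 \<le> x * y + b / q * (x - y) * (x - z\<^sup>2 * y)"
    and "x ^ d + z ^ d * y ^ d
      \<le> q * (x * y + b / q * (x - y) * (x - z\<^sup>2 * y)) powr (real d / 2)"
proof -
  define K where "K = q powr (2 / real d)"
  define L where "L = x ^ d + z ^ d * y ^ d"
  define k where "k = b / q"
  define Q where "Q = x * y + k * (x - y) * (x - z\<^sup>2 * y)"
  have q: "q > 0" using z by (simp add: q_def add_pos_nonneg)
  have K: "K > 0" using q by (simp add: K_def)
  have L: "L \<ge> 0" using assms by (simp add: L_def)
  have s: "slope d z = K * k"
    using q by (simp add: slope_def b_def q_def K_def k_def powr_diff add.commute)
  have "L powr (2 / real d) \<le> slope d z * (x\<^sup>2 + (z * y)\<^sup>2)
      - (slope d z * (1 + z\<^sup>2) - K) / z * x * (z * y)"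
    using power_sum_powr_le[OF d z, of x "z * y"] assms
    by (simp add: L_def K_def q_def power_mult_distrib)
  also have "\<dots> = slope d z * (x\<^sup>2 + (z * y)\<^sup>2) - (slope d z * (1 + z\<^sup>2) - K) * x * y"
    using z by simp
  also have "\<dots> = K * Q"
    unfolding s Q_def by (simp add: algebra_simps power2_eq_square)
  finally have le: "L powr (2 / real d) \<le> K * Q" .
  then have "0 \<le> K * Q" using powr_ge_zero order_trans by blast
  then have Q: "Q \<ge> 0" using K by (simp add: zero_le_mult_iff)
  have "L = (L powr (2 / real d)) powr (real d / 2)"
    using d L by (simp add: powr_powr)
  also have "\<dots> \<le> (K * Q) powr (real d / 2)"
    using le by (intro powr_mono2) auto
  also have "\<dots> = K powr (real d / 2) * Q powr (real d / 2)"
    using K Q by (simp add: powr_mult)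
  also have "K powr (real d / 2) = q"
    using d q by (simp add: K_def powr_powr)
  finally show "x ^ d + z ^ d * y ^ d
      \<le> q * (x * y + b / q * (x - y) * (x - z\<^sup>2 * y)) powr (real d / 2)"
    by (simp add: L_def Q_def k_def)
  show "0 \<le> x * y + b / q * (x - y) * (x - z\<^sup>2 * y)"
    using Q by (simp add: Q_def k_def)
qed

section \<open>The upper bound below the critical value\<close>

text \<open>As \<open>(q - 1) powr (1 - 2/d)\<close> is \<open>z^(d-2)\<close>, the critical value
  is rational in \<open>z\<close>. The condition \<open>z > 1\<close> selects the branch
  \<open>q > 2\<close>.\<close>

lemma w_c_eq:
  assumes d: "d \<ge> 3" and z: "z > 1"
  shows "w_c d (1 + z ^ d) = z ^ d * (z\<^sup>2 - 1) / (z ^ d - z\<^sup>2)"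
proof -
  have r: "z ^ d > z\<^sup>2" "z\<^sup>2 > 1" using d z by auto
  have "(z ^ d) powr (1 - 2 / real d) = z powr (real d - 2)"
    using z d powr_powr[of z "real d" "1 - 2 / real d"]
    by (simp add: powr_realpow right_diff_distrib)
  also have "\<dots> = z ^ d / z\<^sup>2"
    using z by (simp add: powr_diff powr_realpow)
  finally have e: "(z ^ d) powr (1 - 2 / real d) = z ^ d / z\<^sup>2" .
  have "w_c d (1 + z ^ d) = (z ^ d - 1) / (z ^ d / z\<^sup>2 - 1) - 1"
    using r e by (simp add: w_c_def)
  also have "\<dots> = z\<^sup>2 * (z ^ d - 1) / (z ^ d - z\<^sup>2) - 1"
    using r z by (simp add: field_simps)
  also have "\<dots> = z ^ d * (z\<^sup>2 - 1) / (z ^ d - z\<^sup>2)"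
    using r by (simp add: field_simps)
  finally show ?thesis .
qed

lemma sqrt_power_eq_powr: "0 < a \<Longrightarrow> sqrt a ^ d = a powr (real d / 2)"
  using powr_realpow[of "sqrt a" d] by (simp add: powr_powr flip: powr_half_sqrt)

lemma Phi_eq:
  assumes "q > 1"
  shows "Phi d q w t = (sqrt (1 + w / q) * cos t + (q - 1) * sqrt (w / (q * (q - 1))) * sin t) ^ d
     + (q - 1) * (sqrt (1 + w / q) * cos t - sqrt (w / (q * (q - 1))) * sin t) ^ d"
proof -
  have "(q - 1) * w / q = (q - 1)\<^sup>2 * (w / (q * (q - 1)))"
    using assms by (simp add: field_simps power2_eq_square)
  then have "sqrt ((q - 1) * w / q) = (q - 1) * sqrt (w / (q * (q - 1)))"
    using assms by (simp only: real_sqrt_mult real_sqrt_abs)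
  then show ?thesis by (simp add: Phi_def)
qed

text \<open>What the upper bound needs: the first fact removes the mixed term in
  \<open>cos t * sin t\<close>, the second handles the signs of \<open>X\<close> and
  \<open>Y\<close>, and the third is \<open>w \<le> w_c\<close> in a form that makes sense at
  \<open>z = 1\<close> too. For \<open>z > 1\<close> the last two are checked after multiplication
  by \<open>z^2 - 1\<close>.\<close>

lemma critical_coefficient:
  fixes z w :: real
  assumes d: "d \<ge> 3" and z: "z \<ge> 1" and w: "0 \<le> w" "w \<le> w_c d (1 + z ^ d)"
  defines "r \<equiv> z ^ d" and "b \<equiv> (\<Sum>i<d. z ^ i) / (z + 1)"
  shows "b * (z\<^sup>2 - 1) = r - 1"
    and "1 + r \<le> b * (1 + z\<^sup>2)"
    and "w * (b * (r + z\<^sup>2) - 2 * r) \<le> r * (1 + r)"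
proof -
  have "r - 1 = (z - 1) * (\<Sum>i<d. z ^ i)"
    unfolding r_def by (rule power_diff_1_eq)
  then show b: "b * (z\<^sup>2 - 1) = r - 1"
    using z by (simp add: b_def square_diff_one_factored power2_eq_square)
  have "1 + r \<le> b * (1 + z\<^sup>2) \<and> w * (b * (r + z\<^sup>2) - 2 * r) \<le> r * (1 + r)"
  \<comment> \<open>At \<open>z = 1\<close> one has \<open>r = 1\<close> and \<open>b = d/2\<close>,
    so the third fact reads \<open>w (d - 2) \<le> 2\<close>.\<close>
  proof (cases "z = 1")
    case True
    then show ?thesis
      using d w by (simp add: r_def b_def w_c_def field_simps)
  next
    case False
    then have z: "z > 1" using z by simp
    have r: "r > z\<^sup>2" "z\<^sup>2 > 1" using d z by (auto simp: r_def)
    have "(1 + r) * (z\<^sup>2 - 1) \<le> (r - 1) * (1 + z\<^sup>2)"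
      using r by (simp add: algebra_simps)
    also have "\<dots> = (b * (1 + z\<^sup>2)) * (z\<^sup>2 - 1)"
      unfolding b[symmetric] by (simp add: algebra_simps)
    finally have 1: "1 + r \<le> b * (1 + z\<^sup>2)" using r by simp
    have "w * (r - z\<^sup>2) \<le> r * (z\<^sup>2 - 1)"
      using w(2) r unfolding w_c_eq[OF d z] unfolding r_def[symmetric] by (simp add: field_simps)
    then have "(1 + r) * (w * (r - z\<^sup>2)) \<le> (1 + r) * (r * (z\<^sup>2 - 1))"
      using r by (intro mult_left_mono) auto
    moreover have "w * (b * (r + z\<^sup>2) - 2 * r) * (z\<^sup>2 - 1)
        = w * ((b * (z\<^sup>2 - 1)) * (r + z\<^sup>2) - 2 * r * (z\<^sup>2 - 1))"
      by (simp add: algebra_simps)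
    moreover have "\<dots> = (1 + r) * (w * (r - z\<^sup>2))"
      unfolding b by (simp add: algebra_simps power2_eq_square)
    ultimately have "w * (b * (r + z\<^sup>2) - 2 * r) * (z\<^sup>2 - 1) \<le> (r * (1 + r)) * (z\<^sup>2 - 1)"
      by (simp add: algebra_simps)
    then show ?thesis using 1 r by simp
  qed
  then show "1 + r \<le> b * (1 + z\<^sup>2)" "w * (b * (r + z\<^sup>2) - 2 * r) \<le> r * (1 + r)"
    by simp_all
qed

text \<open>After the two-point inequality it remains to bound a quadratic form in \<open>X\<close>
  and \<open>Y\<close>. In \<open>cos t\<close> and \<open>sin t\<close> it is diagonal, with
  coefficient \<open>\<alpha>^2\<close> at the squared cosine and at most \<open>\<alpha>^2\<close>
  at the squared sine.\<close>

lemma Phi_le_of_le_w_c: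
  assumes d: "d \<ge> 3" and z: "z \<ge> 1" and q: "q = 1 + z ^ d" and w: "0 \<le> w" "w \<le> w_c d q"
  shows "Phi d q w t \<le> q * (1 + w / q) powr (real d / 2)"
proof -
  define r where "r = z ^ d"
  define b where "b = (\<Sum>i<d. z ^ i) / (z + 1)"
  define \<alpha> where "\<alpha> = sqrt (1 + w / q)"
  define \<gamma> where "\<gamma> = sqrt (w / (q * r))"
  define X where "X = \<alpha> * cos t + r * \<gamma> * sin t"
  define Y where "Y = \<alpha> * cos t - \<gamma> * sin t"
  have r: "r \<ge> 1" and qr: "q = 1 + r" using z by (simp_all add: r_def q)
  note crit = critical_coefficient[OF d z, of w, folded q r_def b_def, OF w]
  have \<alpha>: "\<alpha>\<^sup>2 = 1 + w / q" and \<gamma>: "\<gamma>\<^sup>2 = w / (q * r)"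
    using w r qr by (simp_all add: \<alpha>_def \<gamma>_def)
  have "Phi d q w t = X ^ d + r * Y ^ d"
    using r by (simp add: Phi_eq qr X_def Y_def \<alpha>_def \<gamma>_def)
  also have "\<dots> \<le> \<bar>X\<bar> ^ d + r * \<bar>Y\<bar> ^ d"
    using r by (intro add_mono mult_left_mono) (simp_all add: abs_le_D1 flip: power_abs)
  also have "\<dots> \<le> q * (\<bar>X\<bar> * \<bar>Y\<bar> + b / q * (\<bar>X\<bar> - \<bar>Y\<bar>) * (\<bar>X\<bar> - z\<^sup>2 * \<bar>Y\<bar>)) powr (real d / 2)"
    using two_point_power_le(2)[of d z "\<bar>X\<bar>" "\<bar>Y\<bar>"] d z by (simp add: q r_def b_def)
  also have "\<dots> \<le> q * (1 + w / q) powr (real d / 2)"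
  proof -
    \<comment> \<open>The two-point inequality was applied to absolute values. Since
      \<open>XY\<close> has coefficient \<open>1 - k (1 + z^2) \<le> 0\<close> in the form, removing
      them can only increase it.\<close>
    define k where "k = b / q"
    have k: "k * q = b" using qr r by (simp add: k_def)
    have "1 \<le> k * (1 + z\<^sup>2)" using crit(2) qr r by (simp add: k_def field_simps)
    then have "(1 - k * (1 + z\<^sup>2)) * (\<bar>X\<bar> * \<bar>Y\<bar> - X * Y) \<le> 0"
      by (intro mult_nonpos_nonneg) (simp_all flip: abs_mult)
    moreover have "\<bar>X\<bar> * \<bar>X\<bar> = X * X" "\<bar>Y\<bar> * \<bar>Y\<bar> = Y * Y" by simp_all
    then have "\<bar>X\<bar> * \<bar>Y\<bar> + k * (\<bar>X\<bar> - \<bar>Y\<bar>) * (\<bar>X\<bar> - z\<^sup>2 * \<bar>Y\<bar>)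
        - (X * Y + k * (X - Y) * (X - z\<^sup>2 * Y)) = (1 - k * (1 + z\<^sup>2)) * (\<bar>X\<bar> * \<bar>Y\<bar> - X * Y)"
      by algebra
    ultimately have "\<bar>X\<bar> * \<bar>Y\<bar> + k * (\<bar>X\<bar> - \<bar>Y\<bar>) * (\<bar>X\<bar> - z\<^sup>2 * \<bar>Y\<bar>)
        \<le> X * Y + k * (X - Y) * (X - z\<^sup>2 * Y)"
      by linarith
    also have "\<dots> = \<alpha>\<^sup>2 * (cos t)\<^sup>2 + \<gamma>\<^sup>2 * (b * (r + z\<^sup>2) - r) * (sin t)\<^sup>2"
    proof -
      have "k * (X - Y) = b * (\<gamma> * sin t)"
        unfolding k[symmetric] by (simp add: X_def Y_def qr algebra_simps)
      then have "X * Y + k * (X - Y) * (X - z\<^sup>2 * Y)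
          = X * Y + b * (\<gamma> * sin t) * (X - z\<^sup>2 * Y)"
        by simp
      also have "\<dots> = \<alpha>\<^sup>2 * (cos t)\<^sup>2 + \<gamma>\<^sup>2 * (b * (r + z\<^sup>2) - r) * (sin t)\<^sup>2
          + \<alpha> * \<gamma> * cos t * sin t * ((r - 1) - b * (z\<^sup>2 - 1))"
        by (simp add: X_def Y_def algebra_simps power2_eq_square)
      finally show ?thesis by (simp add: crit(1))
    qed
    also have "\<dots> \<le> \<alpha>\<^sup>2 * (cos t)\<^sup>2 + \<alpha>\<^sup>2 * (sin t)\<^sup>2"
    proof -
      \<comment> \<open>Here \<open>w \<le> w_c\<close> enters: it bounds the coefficient of the
        squared sine by \<open>\<alpha>^2\<close>.\<close>
      have wb: "w * (b * (r + z\<^sup>2) - r) \<le> r * (q + w)"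
        using crit(3) by (simp add: qr algebra_simps)
      then have "\<gamma>\<^sup>2 * (b * (r + z\<^sup>2) - r) \<le> \<alpha>\<^sup>2"
      proof -
        have "\<gamma>\<^sup>2 * (b * (r + z\<^sup>2) - r) = w * (b * (r + z\<^sup>2) - r) / (q * r)"
          unfolding \<gamma> by simp
        also have "\<dots> \<le> r * (q + w) / (q * r)"
          using wb r qr by (intro divide_right_mono) auto
        also have "\<dots> = \<alpha>\<^sup>2"
          unfolding \<alpha> using r qr by (simp add: add_divide_distrib)
        finally show ?thesis .
      qed
      then show ?thesis by (intro add_left_mono mult_right_mono) auto
    qed
    also have "\<dots> = 1 + w / q"
      unfolding \<alpha> by (simp flip: distrib_left)
    finally have "\<bar>X\<bar> * \<bar>Y\<bar> + b / q * (\<bar>X\<bar> - \<bar>Y\<bar>) * (\<bar>X\<bar> - z\<^sup>2 * \<bar>Y\<bar>) \<le> 1 + w / q"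
      by (simp add: k_def)
    moreover have "0 \<le> \<bar>X\<bar> * \<bar>Y\<bar> + b / q * (\<bar>X\<bar> - \<bar>Y\<bar>) * (\<bar>X\<bar> - z\<^sup>2 * \<bar>Y\<bar>)"
      using two_point_power_le(1)[of d z "\<bar>X\<bar>" "\<bar>Y\<bar>"] d z by (simp add: q r_def b_def)
    ultimately show ?thesis
      using qr r by (intro mult_left_mono powr_mono2) auto
  qed
  finally show ?thesis .
qed

section \<open>Larger values above the critical value\<close>

text \<open>The even part of the binomial expansion in \<open>h\<close> has nonnegative terms, of
  which two are kept. Multiplication by \<open>m + h\<close> and \<open>m - h\<close> mixes even and
  odd parts, so the induction also carries the first term of the odd part.\<close>

lemma power_add_power_diff_ge:
  fixes m h :: real
  assumes "m \<ge> 0" "h \<ge> 0"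
  shows "2 * m ^ Suc (Suc n) + (real n + 2) * (real n + 1) * m ^ n * h\<^sup>2
    \<le> (m + h) ^ Suc (Suc n) + (m - h) ^ Suc (Suc n)"
proof -
  have "2 * m ^ Suc (Suc n) + (real n + 2) * (real n + 1) * m ^ n * h\<^sup>2
      \<le> (m + h) ^ Suc (Suc n) + (m - h) ^ Suc (Suc n) \<and>
    2 * (real n + 2) * m ^ Suc n * h \<le> (m + h) ^ Suc (Suc n) - (m - h) ^ Suc (Suc n)"
  proof (induction n)
    case 0
    show ?case by (simp add: algebra_simps power2_eq_square)
  next
    case (Suc n)
    define P where "P = (m + h) ^ Suc (Suc n)"
    define N where "N = (m - h) ^ Suc (Suc n)"
    have 1: "m * (2 * m ^ Suc (Suc n) + (real n + 2) * (real n + 1) * m ^ n * h\<^sup>2) \<le> m * (P + N)"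
      using Suc assms unfolding P_def N_def by (intro mult_left_mono) auto
    have 2: "h * (2 * (real n + 2) * m ^ Suc n * h) \<le> h * (P - N)"
      using Suc assms unfolding P_def N_def by (intro mult_left_mono) auto
    have 3: "m * (2 * (real n + 2) * m ^ Suc n * h) \<le> m * (P - N)"
      using Suc assms unfolding P_def N_def by (intro mult_left_mono) auto
    have "2 * m ^ Suc (Suc n) \<le> 2 * m ^ Suc (Suc n) + (real n + 2) * (real n + 1) * m ^ n * h\<^sup>2"
      using assms by simp
    also have "\<dots> \<le> P + N" using Suc by (simp add: P_def N_def)
    finally have 4: "h * (2 * m ^ Suc (Suc n)) \<le> h * (P + N)"
      using assms by (intro mult_left_mono) auto
    have PN: "(m + h) ^ Suc (Suc (Suc n)) = (m + h) * P" "(m - h) ^ Suc (Suc (Suc n)) = (m - h) * N"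
      by (simp_all add: P_def N_def)
    show ?case unfolding PN
      using add_mono[OF 1 2] add_mono[OF 3 4] by (simp add: algebra_simps power2_eq_square)
  qed
  then show ?thesis ..
qed

lemma ex_Phi_gt_of_gt_w_c:
  assumes d: "d \<ge> 3" and z: "z > 1" and q: "q = 1 + z ^ d" and w: "w > w_c d q"
  shows "\<exists>t\<in>{-pi..pi}. Phi d q w t > q * (1 + w / q) powr (real d / 2)"
proof -
  define r where "r = z ^ d"
  define \<alpha> where "\<alpha> = sqrt (1 + w / q)"
  define \<gamma> where "\<gamma> = sqrt (w / (q * r))"
  \<comment> \<open>As linear forms in \<open>cos t\<close> and \<open>sin t\<close>,
    \<open>X\<close> and \<open>Y\<close> have squared norms \<open>1 + w\<close> and
    \<open>(r + w) / r\<close>; \<open>g\<close> is the ratio of the norms. The condition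
    \<open>w > w_c\<close> amounts to \<open>g > z\<close>.\<close>
  define g where "g = sqrt (r * (1 + w) / (r + w))"
  have r: "r > z\<^sup>2" "z\<^sup>2 > 1" "r > 1" using d z by (auto simp: r_def)
  have qr: "q = 1 + r" by (simp add: q r_def)
  have wr: "w * (r - z\<^sup>2) > r * (z\<^sup>2 - 1)"
    using w r unfolding q w_c_eq[OF d z] unfolding r_def[symmetric] by (simp add: pos_divide_less_eq)
  moreover have "r * (z\<^sup>2 - 1) > 0" using r by simp
  ultimately have w0: "w > 0" using r by (smt (verit) mult_nonneg_nonneg mult_nonpos_nonneg)
  have \<alpha>: "\<alpha>\<^sup>2 = (q + w) / q" "\<alpha> > 0" and \<gamma>: "\<gamma>\<^sup>2 = w / (q * r)" "\<gamma> > 0"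
    using w0 r qr by (simp_all add: \<alpha>_def \<gamma>_def add_divide_distrib add_pos_pos)
  have g2: "g\<^sup>2 = r * (1 + w) / (r + w)" and g0: "g > 0"
    using w0 r by (simp_all add: g_def)
  have "z\<^sup>2 * (r + w) < r * (1 + w)" using wr by (simp add: algebra_simps)
  then have "z\<^sup>2 < g\<^sup>2" unfolding g2 using w0 r by (simp add: pos_less_divide_eq)
  then have zg: "z < g" using g0 by (intro power2_less_imp_less[of z g]) auto
  \<comment> \<open>\<open>c\<close> and \<open>s\<close> solve \<open>X = \<alpha> g\<close>,
    \<open>Y = \<alpha> / g\<close> for the cosine and sine, via
    \<open>X + r Y = q \<alpha> c\<close> and \<open>X - Y = q \<gamma> s\<close>.\<close>
  define c where "c = (g + r / g) / q"
  define s where "s = \<alpha> * (g - 1 / g) / (q * \<gamma>)"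
  have "1 / g \<le> 1" using zg z by simp
  then have "1 / g \<le> g" using zg z by linarith
  then have "s \<ge> 0" using \<alpha>(2) \<gamma>(2) qr r by (simp add: s_def)
  moreover have "c\<^sup>2 + s\<^sup>2 = 1"
  proof -
    have "c\<^sup>2 = (g\<^sup>2 + 2 * r + r\<^sup>2 / g\<^sup>2) / q\<^sup>2"
      using g0 by (simp add: c_def power_divide power2_sum field_simps power2_eq_square)
    moreover have "s\<^sup>2 = r * (q + w) / w * (g\<^sup>2 - 2 + 1 / g\<^sup>2) / q\<^sup>2"
    proof -
      have "(g - 1 / g)\<^sup>2 = g\<^sup>2 - 2 + 1 / g\<^sup>2"
        using g0 by (simp add: power2_diff power_divide)
      then have "s\<^sup>2 = (\<alpha>\<^sup>2 / \<gamma>\<^sup>2) * (g\<^sup>2 - 2 + 1 / g\<^sup>2) / q\<^sup>2"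
        by (simp add: s_def power_divide power_mult_distrib)
      also have "\<alpha>\<^sup>2 / \<gamma>\<^sup>2 = r * (q + w) / w"
        using r w0 qr by (simp add: \<alpha> \<gamma>)
      finally show ?thesis .
    qed
    ultimately have "c\<^sup>2 + s\<^sup>2 = ((g\<^sup>2 + 2 * r + r\<^sup>2 / g\<^sup>2) + r * (q + w) / w * (g\<^sup>2 - 2 + 1 / g\<^sup>2)) / q\<^sup>2"
      by (simp only: add_divide_distrib)
    also have "\<dots> = 1"
      unfolding g2 qr using w0 r
      by (simp add: divide_simps) (simp add: algebra_simps power2_eq_square)
    finally show ?thesis .
  qed
  ultimately obtain t where t: "0 \<le> t" "t \<le> pi" "c = cos t" "s = sin t"
    using sincos_total_pi by blast
  have q0: "q \<noteq> 0" using r qr by simp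
  have ac: "\<alpha> * c * q = \<alpha> * (g + r * (1 / g))" and gs: "\<gamma> * s * q = \<alpha> * (g - 1 / g)"
    using \<gamma>(2) q0 by (simp_all add: c_def s_def)
  have "(\<alpha> * c + r * \<gamma> * s) * q = \<alpha> * c * q + r * (\<gamma> * s * q)" by (simp add: algebra_simps)
  also have "\<dots> = \<alpha> * g * q" unfolding ac gs unfolding qr by (simp add: algebra_simps)
  finally have X: "\<alpha> * c + r * \<gamma> * s = \<alpha> * g" using q0 by simp
  have "(\<alpha> * c - \<gamma> * s) * q = \<alpha> * c * q - \<gamma> * s * q" by (simp add: algebra_simps)
  also have "\<dots> = (\<alpha> / g) * q" unfolding ac gs unfolding qr by (simp add: algebra_simps add_divide_distrib)
  finally have Y: "\<alpha> * c - \<gamma> * s = \<alpha> / g" using mult_right_cancel[OF q0] by blast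
  have gd: "g ^ d > r" unfolding r_def using zg z d by (intro power_strict_mono) auto
  \<comment> \<open>The function \<open>u + r / u\<close> takes the value \<open>1 + r\<close> at
    \<open>u = 1\<close> and \<open>u = r\<close>, and is larger for \<open>u > r\<close>; here
    \<open>u = g^d\<close>.\<close>
  have "(g ^ d - 1) * (g ^ d - r) > 0" using gd r by simp
  then have "(1 + r) * g ^ d < (g ^ d + r / g ^ d) * g ^ d"
    using g0 by (simp add: distrib_right) (simp add: algebra_simps)
  then have "1 + r < g ^ d + r / g ^ d"
    using g0 by simp
  then have "\<alpha> ^ d * (1 + r) < \<alpha> ^ d * (g ^ d + r / g ^ d)" using \<alpha> by simp
  also have "\<dots> = Phi d q w t"
  proof -
    have "Phi d q w t = (\<alpha> * c + r * \<gamma> * s) ^ d + r * (\<alpha> * c - \<gamma> * s) ^ d"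
      using r by (simp add: Phi_eq qr t(3,4) \<alpha>_def \<gamma>_def)
    then show ?thesis
      unfolding X Y by (simp add: power_mult_distrib power_divide algebra_simps)
  qed
  also have "\<alpha> ^ d = (1 + w / q) powr (real d / 2)"
    unfolding \<alpha>_def using w0 r qr by (intro sqrt_power_eq_powr add_pos_pos divide_pos_pos) auto
  finally show ?thesis using t qr by (intro bexI[of _ t]) (auto simp: mult.commute)
qed

lemma ex_Phi_gt_of_eq_two:
  assumes d: "d \<ge> 3" and w: "w > w_c d 2"
  shows "\<exists>t\<in>{-pi..pi}. Phi d 2 w t > 2 * (1 + w / 2) powr (real d / 2)"
proof -
  obtain n where n: "d = Suc (Suc n)" "n \<ge> 1" using d by (cases d; cases "d - 1") auto
  define \<alpha> where "\<alpha> = sqrt (1 + w / 2)"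
  define \<gamma> where "\<gamma> = sqrt (w / 2)"
  \<comment> \<open>Here \<open>n = d - 2\<close>, so this is \<open>w > 2 / (d - 2)\<close>. It is
    equivalent to \<open>k > n + 2\<close> below.\<close>
  have wn: "w * real n > 2" using w d n by (simp add: w_c_def field_simps)
  then have w0: "w > 0" using n by (smt (verit) mult_nonpos_nonneg of_nat_0_le_iff)
  have \<alpha>: "\<alpha>\<^sup>2 = 1 + w / 2" "\<alpha> > 0" and \<gamma>: "\<gamma>\<^sup>2 = w / 2" "\<gamma> > 0"
    using w0 by (simp_all add: \<alpha>_def \<gamma>_def)
  define k where "k = (real n + 2) * (real n + 1) * (\<gamma>\<^sup>2 / \<alpha>\<^sup>2)"
  have k: "k > real n + 2"
  proof -
    have "1 < (real n + 1) * (\<gamma>\<^sup>2 / \<alpha>\<^sup>2)"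
      unfolding \<alpha> \<gamma> using wn w0 by (simp add: field_simps)
    then have "(real n + 2) * 1 < (real n + 2) * ((real n + 1) * (\<gamma>\<^sup>2 / \<alpha>\<^sup>2))"
      by (intro mult_strict_left_mono) auto
    then show ?thesis by (simp add: k_def mult.assoc)
  qed
  \<comment> \<open>With \<open>S\<close> the squared sine, \<open>f S\<close> is the square of the
    two-term lower bound for \<open>Phi\<close> divided by \<open>\<alpha>^d\<close>. Squaring makes
    it polynomial in \<open>S\<close> for either parity of \<open>n\<close>; \<open>f 0 = 4\<close>
    and \<open>f' 0 > 0\<close>.\<close>
  define f where "f = (\<lambda>S::real. (1 - S) ^ n * (2 * (1 - S) + k * S)\<^sup>2)"
  have "(f has_real_derivative 4 * (k - (real n + 2))) (at 0)"
    unfolding f_def by (auto intro!: derivative_eq_intros simp: algebra_simps)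
  from DERIV_pos_inc_right[OF this] k obtain e where
    e: "e > 0" "\<And>S. 0 < S \<Longrightarrow> S < e \<Longrightarrow> f 0 < f (0 + S)"
    by auto
  define S where "S = min (e / 2) (1 / 2)"
  have S: "0 < S" "S < 1" "4 < f S" using e(1) e(2)[of S] by (auto simp: S_def f_def)
  define s where "s = sqrt S"
  define c where "c = sqrt (1 - S)"
  have cs: "s \<ge> 0" "c \<ge> 0" "s\<^sup>2 = S" "c\<^sup>2 = 1 - S" using S by (simp_all add: s_def c_def)
  then obtain t where t: "0 \<le> t" "t \<le> pi" "c = cos t" "s = sin t"
    using sincos_total_pi[of s c] by auto
  have "2\<^sup>2 < (c ^ n * (2 * c\<^sup>2 + k * s\<^sup>2))\<^sup>2"
  proof -
    have "(c ^ n)\<^sup>2 = (c\<^sup>2) ^ n" by (simp add: power2_eq_square power_mult_distrib)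
    then show ?thesis using S(3) by (simp add: f_def power_mult_distrib cs(3,4))
  qed
  then have "2 < c ^ n * (2 * c\<^sup>2 + k * s\<^sup>2)"
    using cs(1,2) k by (intro power2_less_imp_less[of 2]) auto
  then have "\<alpha> ^ d * 2 < \<alpha> ^ d * (c ^ n * (2 * c\<^sup>2 + k * s\<^sup>2))"
    using \<alpha> by simp
  also have "\<dots> = 2 * (\<alpha> * c) ^ Suc (Suc n)
      + (real n + 2) * (real n + 1) * (\<alpha> * c) ^ n * (\<gamma> * s)\<^sup>2"
    using \<alpha>(2) by (simp add: n k_def power_mult_distrib power2_eq_square field_simps)
  also have "\<dots> \<le> (\<alpha> * c + \<gamma> * s) ^ d + (\<alpha> * c - \<gamma> * s) ^ d"
    unfolding n using \<alpha> \<gamma> cs by (intro power_add_power_diff_ge) auto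
  also have "\<dots> = Phi d 2 w t"
    by (simp add: Phi_eq t(3,4) \<alpha>_def \<gamma>_def)
  also have "\<alpha> ^ d = (1 + w / 2) powr (real d / 2)"
    using w0 by (simp add: \<alpha>_def sqrt_power_eq_powr)
  finally show ?thesis using t by (intro bexI[of _ t]) (auto simp: mult.commute)
qed

section \<open>The two regimes combined\<close>

theorem theorem3p49:
  fixes d :: nat and q w :: real
  assumes "d \<ge> 3" and "q \<ge> 2"
  shows "(0 \<le> w \<and> w \<le> w_c d q \<longrightarrow>
            Phi_max d q w = q * (1 + w / q) powr (real d / 2))
       \<and> (w > w_c d q \<longrightarrow>
            Phi_max d q w > q * (1 + w / q) powr (real d / 2))"
proof -
  define z where "z = (q - 1) powr (1 / real d)"
  have z: "z \<ge> 1" using assms by (simp add: z_def ge_one_powr_ge_zero)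
  have q: "q = 1 + z ^ d"
    using assms by (simp add: z_def powr_powr flip: powr_realpow)
  show ?thesis
  proof (intro conjI impI; (elim conjE)?)
    assume w: "0 \<le> w" "w \<le> w_c d q"
    \<comment> \<open>At \<open>t = 0\<close> both bases equal \<open>sqrt (1 + w / q)\<close>, so
      the upper bound is attained.\<close>
    have "Phi d q w 0 = q * sqrt (1 + w / q) ^ d"
      by (simp add: Phi_def algebra_simps)
    also have "sqrt (1 + w / q) ^ d = (1 + w / q) powr (real d / 2)"
      using w assms by (intro sqrt_power_eq_powr add_pos_nonneg) auto
    finally have "q * (1 + w / q) powr (real d / 2) \<le> Phi_max d q w"
      using Phi_max_attained(2)[of 0 d q w] by simp
    moreover have "Phi_max d q w \<le> q * (1 + w / q) powr (real d / 2)"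
      using Phi_max_attained(1)[of d q w] Phi_le_of_le_w_c[OF assms(1) z q w] by auto
    ultimately show "Phi_max d q w = q * (1 + w / q) powr (real d / 2)" by simp
  next
    assume w: "w > w_c d q"
    have "\<exists>t\<in>{-pi..pi}. Phi d q w t > q * (1 + w / q) powr (real d / 2)"
    proof (cases "z = 1")
      case True
      then have "q = 2" using q by simp
      then show ?thesis using ex_Phi_gt_of_eq_two assms w by simp
    next
      case False
      then show ?thesis using ex_Phi_gt_of_gt_w_c[OF assms(1) _ q w] z by simp
    qed
    then show "Phi_max d q w > q * (1 + w / q) powr (real d / 2)"
      using Phi_max_attained(2) by (meson less_le_trans)
  qed
qed

end
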